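(* For every positive integer $m$, there exists a $12m$-tuple $A_m$ of elements of $\mathbb{Z}/m\mathbb{Z}$ such that, for every non-negative integer $\lambda$, the Steinhaus triangle modulo $m$ whose first row is $A_m^{\lambda}$ (the tuple $A_m$ repeated $\lambda$ times, of length $12\lambda m$) is balanced.
   Context: Let $T_n=\{(i,j)\in\mathbb{N}^2 : i+j<n\}$. A Steinhaus triangle modulo $m$ of size $n$ is a family $(a_{i,j})_{(i,j)\in T_n}$ of elements of $\mathbb{Z}/m\mathbb{Z}$ satisfying $a_{i,j}=a_{i-1,j}+a_{i-1,j+1}$ for all $(i,j)\in T_n$ with $i\ge 1$; it is determined by its first row $(a_{0,j})_{j=0}^{n-1}$. It is called balanced if every element of $\mathbb{Z}/m\mathbb{Z}$ occurs the same number of times among its $n(n+1)/2$ entries (the empty triangle, $n=0$, is balanced). *)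

theory Defs
  imports Main
begin

text \<open>Elements of Z/mZ are represented by their canonical representatives in {0..<m}
  (integers), with arithmetic taken mod m.  A tuple is a list of such representatives.\<close>

fun steinhaus :: "int \<Rightarrow> int list \<Rightarrow> nat \<Rightarrow> nat \<Rightarrow> int" where
  "steinhaus m xs 0 j = (xs ! j) mod m"
| "steinhaus m xs (Suc i) j = (steinhaus m xs i j + steinhaus m xs i (Suc j)) mod m"

definition tri_idx :: "nat \<Rightarrow> (nat \<times> nat) set" where
  "tri_idx n = {(i, j). i + j < n}"

definition balanced :: "int \<Rightarrow> int list \<Rightarrow> bool" where
  "balanced m xs \<longleftrightarrow>
     (\<forall>x\<in>{0..<m}. \<forall>y\<in>{0..<m}.
        card {(i, j) \<in> tri_idx (length xs). steinhaus m xs i j = x}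
      = card {(i, j) \<in> tri_idx (length xs). steinhaus m xs i j = y})"

end

theory Submission
  imports Defs Complex_Main "HOL-Number_Theory.Cong"
begin

text \<open>
  Write \<open>m = 2\<^sup>k q\<close> with \<open>q\<close> odd, let \<open>E\<close> be the shift on sequences, so that passing to the next row
  of a triangle is \<open>1 + E\<close>, and take for the first row \<open>q u + 2\<^sup>k v\<close> with two fixed integer sequences.
  By Fourier inversion on \<open>Z/mZ\<close> it suffices that every nontrivial character \<open>\<chi>\<close> sums to \<open>0\<close> over the
  triangle. If the array is doubly arithmetic with step \<open>N\<close>, i.e. \<open>\<chi>\<close> picks up constant factors \<open>C\<close> and
  \<open>D\<close> (depending on residues modulo \<open>N\<close>) when moving by \<open>N\<close> down or to the right, the triangle splits
  into triangular double geometric sums, and these vanish as soon as \<open>C\<close>, \<open>D\<close> and \<open>C/D\<close> all differ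
  from \<open>1\<close>.

  The increments are governed by \<open>\<delta> = (1, -2, 1, 1, -2, 1, \<dots>)\<close>, which satisfies \<open>(1 + E) \<delta> = -E\<^sup>2 \<delta>\<close>, so
  all increments are \<open>\<plusminus>1, \<plusminus>2\<close> up to a common factor. The sequence \<open>v\<close> interlaces three arithmetic
  progressions and handles the characters that are nontrivial on the odd part. The sequence \<open>u\<close>
  interlaces 24 progressions with differences \<open>2 \<delta>\<close>; it is killed by
  \<open>(x\<^sup>2 + x + 1) (x\<^sup>1\<^sup>6 + x\<^sup>8 + 1)\<close> and was found by a lattice search so that
  \<open>(1 + E)\<^bsup>24\<cdot>2^t\<^esup> u \<equiv> u + 2\<^bsup>t+1\<^esup> (1 + E) \<delta>\<close> modulo \<open>2\<^bsup>t+3\<^esup>\<close> for all \<open>t\<close>. A character of order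
  \<open>2\<^sup>s\<close> with \<open>s \<ge> 3\<close> is then handled with \<open>N = 3 \<cdot> 2\<^sup>s\<close>, where the factors are fourth roots of unity.
  For orders 2 and 4 the values are periodic with period 24 and 48, and two triangles of one and
  two periods are checked by computation.
\<close>

subsection \<open>Integer orbits of the Pascal rule\<close>

fun orbit :: "(nat \<Rightarrow> int) \<Rightarrow> nat \<Rightarrow> nat \<Rightarrow> int" where
  "orbit f 0 j = f j"
| "orbit f (Suc i) j = orbit f i j + orbit f i (Suc j)"

lemma orbit_linear:
  "orbit (\<lambda>j. a * f j + b * g j) i j = a * orbit f i j + b * orbit g i j"
  by (induction i arbitrary: j) (simp_all add: algebra_simps)

lemma orbit_shift: "orbit (\<lambda>j. f (j + s)) i j = orbit f i (j + s)"
  by (induction i arbitrary: j) simp_all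

lemma orbit_orbit: "orbit (orbit f k) i j = orbit f (i + k) j"
  by (induction i arbitrary: j) simp_all

lemma orbit_cong:
  assumes "\<And>j. [f j = g j] (mod K)"
  shows "[orbit f i j = orbit g i j] (mod K)"
  using assms by (induction i arbitrary: j) (simp_all add: cong_add)

definition delta :: "nat \<Rightarrow> int" where
  "delta j = (if j mod 3 = 1 then -2 else 1)"

lemma delta_sum: "delta j + delta (Suc j) = - delta (Suc (Suc j))"
  by (auto simp: delta_def mod_Suc)

lemma delta_add_mult: "delta (j + 3 * k) = delta j"
  by (simp add: delta_def)

lemma orbit_delta: "orbit delta i j = (- 1) ^ i * delta (j + 2 * i)"
proof (induction i arbitrary: j)
  case (Suc i)
  have "orbit delta (Suc i) j = (- 1) ^ i * (delta (j + 2 * i) + delta (Suc (j + 2 * i)))"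
    by (simp add: Suc algebra_simps)
  also have "\<dots> = (- 1) ^ Suc i * delta (j + 2 * Suc i)"
    by (simp only: delta_sum) simp
  finally show ?case .
qed simp

text \<open>In \<open>orbit_delta\<close> the sign has period 2 in \<open>i\<close> and the shift by
  \<open>2 * i\<close> has period 3 modulo 3, so every multiple of 6 is a period in the row
  index.\<close>

lemma orbit_delta_add:
  assumes "6 dvd N"
  shows "orbit delta (i + N) j = orbit delta i j"
proof -
  obtain k where k: "N = 6 * k" using assms by blast
  have "j + 2 * (i + N) = (j + 2 * i) + 3 * (4 * k)" by (simp add: k)
  then have "delta (j + 2 * (i + N)) = delta (j + 2 * i)" by (simp only: delta_add_mult)
  then show ?thesis by (simp add: orbit_delta power_add k power_mult)
qed

lemma orbit_delta_values: "orbit delta i j \<in> {1, - 1, 2, - 2}"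
proof (cases "even i")
  case True
  then show ?thesis by (simp add: orbit_delta delta_def)
next
  case False
  then show ?thesis by (simp add: orbit_delta delta_def)
qed

text \<open>Since 6 divides \<open>N\<close>, all rows of \<open>orbit delta\<close> are unchanged
  by moving \<open>N\<close> down or to the right. The increments given by \<open>col\<close> and
  \<open>row\<close> are therefore the same at each step and accumulate linearly in \<open>I\<close>
  and \<open>J\<close>. The index \<open>Suc r\<close> arises because the increment downwards is
  itself one row further on than the one to the right.\<close>

lemma orbit_grid:
  assumes N: "6 dvd N"
    and col: "\<And>j. [orbit f N j = f j + c * orbit delta 1 j] (mod K)"
    and row: "\<And>j. f (j + N) = f j + c * delta j"
  shows "[orbit f (r + N * I) (s + N * J) =
          orbit f r s + c * (int I * orbit delta (Suc r) s + int J * orbit delta r s)] (mod K)"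
proof -
  have cols: "[orbit f (r + N * I) j = orbit f r j + c * (int I * orbit delta (Suc r) j)] (mod K)"
    for j
  proof (induction I)
    case (Suc I)
    \<comment> \<open>The \<open>N\<close> additional rows are taken first, directly on
      \<open>f\<close>, where \<open>col\<close> applies.\<close>
    have "orbit f (r + N * Suc I) j = orbit (orbit f N) (r + N * I) j"
      by (simp add: orbit_orbit ac_simps)
    also have "[orbit (orbit f N) (r + N * I) j
        = orbit (\<lambda>j. 1 * f j + c * orbit delta 1 j) (r + N * I) j] (mod K)"
      by (rule orbit_cong) (use col in simp)
    also have "orbit (\<lambda>j. 1 * f j + c * orbit delta 1 j) (r + N * I) j
        = orbit f (r + N * I) j + c * orbit delta (Suc r + N * I) j"
      by (simp only: orbit_linear orbit_orbit) simp
    also have "orbit delta (Suc r + N * I) j = orbit delta (Suc r) j"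
      using N by (intro orbit_delta_add) simp
    also have "[orbit f (r + N * I) j + c * orbit delta (Suc r) j
        = (orbit f r j + c * (int I * orbit delta (Suc r) j)) + c * orbit delta (Suc r) j] (mod K)"
      by (intro cong_add Suc) simp
    finally show ?case by (simp add: algebra_simps)
  qed simp
  have per: "orbit delta i (s + N * J) = orbit delta i s" for i
  proof -
    obtain k where "N = 6 * k" using N by blast
    then have "s + N * J + 2 * i = (s + 2 * i) + 3 * (2 * k * J)" by simp
    then show ?thesis by (simp only: orbit_delta delta_add_mult)
  qed
  have "f (j + N * J) = f j + c * int J * delta j" for j
  proof (induction J)
    case (Suc J)
    obtain k where "N = 6 * k" using N by blast
    then have "delta (j + N * J) = delta j"
      using delta_add_mult[of j "2 * k * J"] by (simp add: ac_simps)
    then show ?case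
      using row[of "j + N * J"] Suc by (simp add: algebra_simps)
  qed simp
  then have "orbit f r (s + N * J) = orbit (\<lambda>j. 1 * f j + (c * int J) * delta j) r s"
    by (simp add: orbit_shift[symmetric])
  then have "orbit f r (s + N * J) = orbit f r s + c * (int J * orbit delta r s)"
    by (simp only: orbit_linear)
  then show ?thesis
    using cols[of "s + N * J"] unfolding per by (simp add: algebra_simps del: orbit.simps)
qed

text \<open>The sequences \<open>odd_row\<close> and \<open>dyadic_row\<close> are \<open>v\<close> and \<open>u\<close> above.\<close>

definition odd_row :: "nat \<Rightarrow> int" where
  "odd_row j = delta j * int (j div 3)"

text \<open>Here \<open>g\<close> is the defect \<open>(1 + E + E^2) v\<close>, and
  \<open>1 + E + E^2\<close> kills \<open>g\<close>. Expanding
  \<open>(1 + E)^i = (- E^2 + (1 + E + E^2))^i\<close> on \<open>v\<close> thus stops after the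
  first-order term. Its argument \<open>j + 2 * i - 2\<close> is written
  \<open>Suc (j + 2 * i)\<close>, which is the same modulo 3.\<close>

lemma orbit_odd_row:
  defines "g \<equiv> \<lambda>j::nat. (if j mod 3 = 0 then 0 else if j mod 3 = 1 then 1 else -1 :: int)"
  shows "orbit odd_row i j = (- 1) ^ i * (odd_row (j + 2 * i) - int i * g (Suc (j + 2 * i)))"
proof (induction i arbitrary: j)
  case (Suc i)
  define l where "l = j + 2 * i"
  have v: "odd_row l + odd_row (Suc l) = g l - odd_row (Suc (Suc l))"
    by (auto simp: odd_row_def g_def delta_def mod_Suc div_Suc)
  have g: "g (Suc l) + g (Suc (Suc l)) = - g l" "g (Suc (Suc (Suc l))) = g l"
    by (auto simp: g_def mod_Suc)
  have "orbit odd_row (Suc i) j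
      = (- 1) ^ i * ((odd_row l + odd_row (Suc l)) - int i * (g (Suc l) + g (Suc (Suc l))))"
    by (simp add: Suc l_def algebra_simps)
  also have "\<dots> = (- 1) ^ Suc i * (odd_row (Suc (Suc l)) - int (Suc i) * g (Suc (Suc (Suc l))))"
    by (simp add: v g algebra_simps)
  finally show ?case by (simp add: l_def)
qed simp

lemma odd_row_grid:
  "orbit odd_row (r + 12 * M * I) (s + 12 * M * J) = orbit odd_row r s
     + 4 * int M * (int I * orbit delta (Suc r) s + int J * orbit delta r s)"
proof -
  \<comment> \<open>Modulus 0 turns the congruence of \<open>orbit_grid\<close> into an
    equality.\<close>
  have "[orbit odd_row (r + 12 * M * I) (s + 12 * M * J) = orbit odd_row r s
     + 4 * int M * (int I * orbit delta (Suc r) s + int J * orbit delta r s)] (mod 0)"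
  proof (rule orbit_grid)
    show row: "odd_row (j + 12 * M) = odd_row j + 4 * int M * delta j" for j
    proof -
      have "(j + 12 * M) div 3 = j div 3 + 4 * M" by simp
      moreover have "delta (j + 12 * M) = delta j"
        using delta_add_mult[of j "4 * M"] by simp
      ultimately show ?thesis by (simp add: odd_row_def algebra_simps)
    qed
    \<comment> \<open>By the closed form this reduces to
      \<open>2 * delta j - 3 * g (Suc j) = - delta (j + 2)\<close>, checked for each residue of
      \<open>j\<close> modulo 3.\<close>
    show "[orbit odd_row (12 * M) j = odd_row j + 4 * int M * orbit delta 1 j] (mod 0)" for j
    proof -
      have "odd_row (j + 2 * (12 * M)) = odd_row j + 8 * int M * delta j"
        using row[of "j + 12 * M"] row[of j] delta_add_mult[of j "4 * M"] by (simp add: algebra_simps)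
      moreover have "(Suc (j + 2 * (12 * M))) mod 3 = Suc j mod 3"
        using mod_mult_self2[of "Suc j" 3 "8 * M"] by (simp add: ac_simps)
      ultimately show ?thesis
        by (auto simp: orbit_odd_row delta_def mod_Suc power_mult)
    qed
  qed auto
  then show ?thesis by (simp add: cong_def)
qed

subsection \<open>The linear recurrence behind the dyadic row\<close>

text \<open>The coefficients are those of \<open>(x^2 + x + 1) (x^16 + x^8 + 1)\<close>, read as a
  polynomial in the shift.\<close>

definition sparse_rec :: "(nat \<Rightarrow> int) \<Rightarrow> bool" where
  "sparse_rec f \<longleftrightarrow> (\<forall>j. f j + f (j + 1) + f (j + 2) + f (j + 8) + f (j + 9) + f (j + 10)
     + f (j + 16) + f (j + 17) + f (j + 18) = 0)"

lemma sparse_rec_linear: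
  assumes "sparse_rec f" "sparse_rec g"
  shows "sparse_rec (\<lambda>j. a * f j + b * g j)"
  unfolding sparse_rec_def
proof
  fix j
  have "a * (f j + f (j + 1) + f (j + 2) + f (j + 8) + f (j + 9) + f (j + 10)
      + f (j + 16) + f (j + 17) + f (j + 18)) + b * (g j + g (j + 1) + g (j + 2) + g (j + 8)
      + g (j + 9) + g (j + 10) + g (j + 16) + g (j + 17) + g (j + 18)) = 0"
    using assms unfolding sparse_rec_def by simp
  then show "a * f j + b * g j + (a * f (j + 1) + b * g (j + 1)) + (a * f (j + 2) + b * g (j + 2))
    + (a * f (j + 8) + b * g (j + 8)) + (a * f (j + 9) + b * g (j + 9))
    + (a * f (j + 10) + b * g (j + 10)) + (a * f (j + 16) + b * g (j + 16))
    + (a * f (j + 17) + b * g (j + 17)) + (a * f (j + 18) + b * g (j + 18)) = 0"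
    by (simp only: distrib_left)
qed

lemma sparse_rec_orbit:
  assumes "sparse_rec f"
  shows "sparse_rec (orbit f i)"
proof (induction i)
  case 0
  then show ?case using assms by (simp add: sparse_rec_def)
next
  case (Suc i)
  have "sparse_rec (\<lambda>j. orbit f i (Suc j))"
    unfolding sparse_rec_def
  proof
    fix j show "orbit f i (Suc j) + orbit f i (Suc (j + 1)) + orbit f i (Suc (j + 2))
      + orbit f i (Suc (j + 8)) + orbit f i (Suc (j + 9)) + orbit f i (Suc (j + 10))
      + orbit f i (Suc (j + 16)) + orbit f i (Suc (j + 17)) + orbit f i (Suc (j + 18)) = 0"
      using Suc[unfolded sparse_rec_def, rule_format, of "Suc j"] by simp
  qed
  from sparse_rec_linear[OF Suc this, of 1 1] show ?case
    by (simp add: sparse_rec_def)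
qed

lemma sparse_rec_cancel:
  assumes "sparse_rec (\<lambda>j. c * f j)" "c \<noteq> 0"
  shows "sparse_rec f"
  unfolding sparse_rec_def
proof
  fix j
  have "c * (f j + f (j + 1) + f (j + 2) + f (j + 8) + f (j + 9) + f (j + 10)
      + f (j + 16) + f (j + 17) + f (j + 18)) = 0"
    using assms(1)[unfolded sparse_rec_def, rule_format, of j] by (simp only: distrib_left)
  then show "f j + f (j + 1) + f (j + 2) + f (j + 8) + f (j + 9) + f (j + 10)
      + f (j + 16) + f (j + 17) + f (j + 18) = 0"
    using assms(2) by (simp only: mult_eq_0_iff simp_thms)
qed

text \<open>The recurrence is monic of order 18 with integer coefficients, so a divisibility claim
  for all \<open>j\<close> becomes a finite check.\<close>

lemma sparse_rec_dvd:
  assumes "sparse_rec f" "\<And>j. j < 18 \<Longrightarrow> c dvd f j"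
  shows "c dvd f j"
proof (induction j rule: less_induct)
  case (less j)
  show ?case
  proof (cases "j < 18")
    case False
    then obtain l where l: "j = l + 18" by (metis add.commute le_Suc_ex not_less)
    have "f j = - (f l + f (l + 1) + f (l + 2) + f (l + 8) + f (l + 9) + f (l + 10)
      + f (l + 16) + f (l + 17))"
      unfolding l using assms(1)[unfolded sparse_rec_def, rule_format, of l] by linarith
    moreover have "c dvd f l + f (l + 1) + f (l + 2) + f (l + 8) + f (l + 9) + f (l + 10)
      + f (l + 16) + f (l + 17)"
      by (intro dvd_add less) (simp_all add: l)
    ultimately show ?thesis by (simp only: dvd_minus_iff)
  qed (rule assms(2))
qed

text \<open>Modulo 2 the recurrence polynomial is \<open>(x\<^sup>2 + x + 1)\<^sup>9\<close>, which divides
  \<open>(x\<^sup>2 + x + 1)\<^sup>1\<^sup>6 = x\<^sup>3\<^sup>2 + x\<^sup>1\<^sup>6 + 1\<close>; the cofactor \<open>(x\<^sup>2 + x + 1)\<^sup>7\<close> has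
  the odd coefficients used below.\<close>

lemma sparse_rec_even:
  assumes "sparse_rec f"
  shows "even (f j + f (j + 16) + f (j + 32))"
proof -
  define g where "g = (\<lambda>i. f (j + i))"
  have G: "g i + g (i + 1) + g (i + 2) + g (i + 8) + g (i + 9) + g (i + 10)
      + g (i + 16) + g (i + 17) + g (i + 18) = 0" for i
    using assms[unfolded sparse_rec_def, rule_format, of "j + i"] by (simp add: g_def add.assoc)
  have "g 0 + g 16 + g 32 = - 2 * (g 1 + g 2 + g 3 + g 4 + g 5 + g 6 + g 7 + g 8 + g 9 + g 10
      + g 11 + g 12 + g 13 + g 14 + g 15 + g 16 + g 17 + g 18 + g 19 + g 20
      + g 21 + g 22 + g 23 + g 24 + g 25 + g 26 + g 27 + g 28 + g 29 + g 30
      + g 31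
      + g 8 + g 9 + g 10 + g 11 + g 12 + g 13 + g 14 + g 15 + g 16 + g 17
      + g 18 + g 19 + g 20 + g 21 + g 22 + g 23 + g 24)"
    using G[of 0] G[of 1] G[of 3] G[of 4] G[of 6] G[of 7] G[of 8] G[of 10] G[of 11] G[of 13] G[of 14]
    by (simp del: One_nat_def add_2_eq_Suc add_2_eq_Suc')
  then have "even (g 0 + g 16 + g 32)"
    by (simp only: even_mult_iff even_minus even_numeral simp_thms)
  then show ?thesis by (simp add: g_def)
qed

text \<open>Squaring modulo 2: \<open>(1 + E)^n = 1 + E^n\<close> implies
  \<open>(1 + E)^(2 n) = 1 + E^(2 n)\<close>.\<close>

lemma orbit_double_even:
  assumes "\<And>f j. even (orbit f n j - (f j + f (j + n)))"
  shows "even (orbit f (2 * n) j - (f j + f (j + 2 * n)))"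
proof -
  define e where "e = (\<lambda>f j. orbit f n j - (f j + f (j + n)))"
  have "orbit f (2 * n) j - (f j + f (j + 2 * n))
      = e (orbit f n) j + e f j + e f (j + n) + 2 * f (j + n)"
    unfolding e_def orbit_orbit mult_2 add.assoc by simp
  moreover have "even (e f i)" for f i
    unfolding e_def by (rule assms)
  ultimately show ?thesis by (simp only: even_add even_mult_iff even_numeral simp_thms)
qed

lemma orbit_16_even: "even (orbit f 16 j - (f j + f (j + 16)))"
proof -
  have 1: "even (orbit f 1 j - (f j + f (j + 1)))" for f j by simp
  note 2 = orbit_double_even[OF 1] note 4 = orbit_double_even[OF 2]
  note 8 = orbit_double_even[OF 4] note 16 = orbit_double_even[OF 8]
  show ?thesis using 16[of f j] by simp
qed

text \<open>Modulo 2, \<open>(1 + E)^48 = (1 + E^16)^3 = 1 + E^16 (1 + E^16 + E^32)\<close>, and the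
  last factor kills the sequence by \<open>sparse_rec_even\<close>.\<close>

lemma sparse_rec_orbit_48_even:
  assumes "sparse_rec f"
  shows "even (orbit f (48 * M) j - f j)"
proof (induction M)
  case (Suc M)
  have "even (orbit g 48 j - g j)" if g: "sparse_rec g" for g
  proof -
    define h e where "h = orbit g 16" and "e = (\<lambda>f j. orbit f 16 j - (f j + f (j + 16)))"
    define t where "t = g (j + 16) + g (j + 16 + 16) + g (j + 16 + 32)"
    have "orbit g 48 j - g j = e (orbit h 16) j + e h j + e h (j + 16)
        + e g j + 2 * e g (j + 16) + e g (j + 32) + t + 2 * (g (j + 16) + g (j + 32))"
      by (simp add: orbit_orbit add.assoc e_def h_def t_def)
    moreover have "even (e f i)" for f i
      unfolding e_def by (rule orbit_16_even)
    moreover have "even t"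
      unfolding t_def by (rule sparse_rec_even[OF g])
    ultimately show ?thesis by (simp only: even_add even_mult_iff even_numeral simp_thms)
  qed
  from this[OF sparse_rec_orbit[OF assms, of "48 * M"]]
  have "even (orbit f (48 * Suc M) j - orbit f (48 * M) j)"
    by (simp only: orbit_orbit mult_Suc_right)
  then have "even ((orbit f (48 * Suc M) j - orbit f (48 * M) j) + (orbit f (48 * M) j - f j))"
    using Suc by (rule dvd_add)
  then show ?case by (simp only: diff_add_cancel add_diff_eq)
qed simp

subsection \<open>The dyadic row\<close>

definition dyadic_row :: "nat \<Rightarrow> int" where
  "dyadic_row j = [-1,0,0,-1,0,1,-1,2,-1,0,0,1,2,0,-1,0,0,2,0,-2,0,-1,0,0] ! (j mod 24)
     + 2 * delta j * int (j div 24)"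

lemma dyadic_row_add: "dyadic_row (j + 24 * M) = dyadic_row j + 2 * int M * delta j"
  using delta_add_mult[of j "8 * M"] by (simp add: dyadic_row_def algebra_simps)

lemma sparse_rec_delta: "sparse_rec delta"
  unfolding sparse_rec_def
proof
  fix j
  have "delta i + delta (i + 1) + delta (i + 2) = 0" for i
    using delta_sum[of i] by simp
  from this[of j] this[of "j + 8"] this[of "j + 16"]
  show "delta j + delta (j + 1) + delta (j + 2) + delta (j + 8) + delta (j + 9) + delta (j + 10)
    + delta (j + 16) + delta (j + 17) + delta (j + 18) = 0"
    unfolding add.assoc[of j] by simp
qed

lemma upt_0_conv_Cons: "2 \<le> n \<Longrightarrow> [0..<n] = 0 # 1 # [2..<n]"
  by (simp add: upt_conv_Cons numeral_2_eq_2)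

text \<open>A shift by 24 adds a multiple of \<open>delta\<close>, which satisfies the recurrence,
  so only the 24 residues need checking.\<close>

lemma sparse_rec_dyadic_row: "sparse_rec dyadic_row"
  unfolding sparse_rec_def
proof
  fix j :: nat
  define r where "r = j mod 24"
  have d: "dyadic_row (j + i) = dyadic_row (r + i) + 2 * int (j div 24) * delta (r + i)" for i
    using dyadic_row_add[of "r + i" "j div 24"] by (simp add: r_def ac_simps)
  have "list_all (\<lambda>r. dyadic_row r + dyadic_row (r + 1) + dyadic_row (r + 2)
    + dyadic_row (r + 8) + dyadic_row (r + 9) + dyadic_row (r + 10)
    + dyadic_row (r + 16) + dyadic_row (r + 17) + dyadic_row (r + 18) = 0) [0..<24]"
    by (simp add: upt_0_conv_Cons) (simp add: dyadic_row_def delta_def)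
  moreover have "r \<in> set [0..<24]" by (simp add: r_def)
  ultimately have "dyadic_row r + dyadic_row (r + 1) + dyadic_row (r + 2)
    + dyadic_row (r + 8) + dyadic_row (r + 9) + dyadic_row (r + 10)
    + dyadic_row (r + 16) + dyadic_row (r + 17) + dyadic_row (r + 18) = 0"
    unfolding list_all_iff by blast
  then show "dyadic_row j + dyadic_row (j + 1) + dyadic_row (j + 2)
    + dyadic_row (j + 8) + dyadic_row (j + 9) + dyadic_row (j + 10)
    + dyadic_row (j + 16) + dyadic_row (j + 17) + dyadic_row (j + 18) = 0"
    using arg_cong[OF sparse_rec_delta[unfolded sparse_rec_def, rule_format, of r],
        of "\<lambda>x. 2 * int (j div 24) * x"] d[of 0]
    unfolding d distrib_left add_0_right mult_zero_right by linarith
qed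

section \<open>Evaluating rows modulo m\<close>

fun next_row :: "int \<Rightarrow> int list \<Rightarrow> int list" where
  "next_row m (x # y # xs) = ((x + y) mod m) # next_row m (y # xs)"
| "next_row m _ = []"

lemma next_row_map_upt:
  "next_row m (map g [a..<a + Suc n]) = map (\<lambda>j. (g j + g (Suc j)) mod m) [a..<a + n]"
proof (induction n arbitrary: a)
  case (Suc n)
  have "next_row m (map g [a..<a + Suc (Suc n)])
      = next_row m (g a # map g [Suc a..<Suc a + Suc n])"
    by (simp add: upt_conv_Cons del: upt_Suc)
  also have "\<dots> = ((g a + g (Suc a)) mod m) # next_row m (map g [Suc a..<Suc a + Suc n])"
    by (simp add: upt_conv_Cons del: upt_Suc)
  also have "\<dots> = map (\<lambda>j. (g j + g (Suc j)) mod m) [a..<a + Suc n]"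
    unfolding Suc by (simp add: upt_conv_Cons del: upt_Suc)
  finally show ?case .
qed simp

lemma next_row_orbit:
  "next_row m (map (\<lambda>j. orbit f i j mod m) [0..<Suc n]) = map (\<lambda>j. orbit f (Suc i) j mod m) [0..<n]"
  using next_row_map_upt[of m _ 0 n] by (simp add: mod_add_eq del: upt_Suc)

lemma next_row_funpow:
  "(next_row m ^^ k) (map (\<lambda>j. orbit f i j mod m) [0..<n + k])
     = map (\<lambda>j. orbit f (i + k) j mod m) [0..<n]"
proof (induction k arbitrary: n)
  case (Suc k)
  then show ?case using Suc[of "Suc n"] next_row_orbit[of m f "i + k" n] by (simp del: upt_Suc orbit.simps)
qed simp

text \<open>Each row costs one entry: 18 entries of row 48 need 42 of row 24, and these need 66 of
  row 0. The modulus 16 is the one needed for the check on row 48.\<close>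

lemma dyadic_row_orbit_24:
  "map (\<lambda>j. orbit dyadic_row 24 j mod 16) [0..<42] =
    [5, 6, 12, 13, 6, 13, 5, 0, 11, 6, 6, 13, 8, 14, 11, 6, 14, 6, 14, 4, 4, 5, 14, 12, 7, 2, 14,
     15, 2, 15, 7, 12, 13, 8, 2, 15, 10, 10, 13, 8, 10, 8]"
proof -
  have "map (\<lambda>j. orbit dyadic_row 24 j mod 16) [0..<42]
      = (next_row 16 ^^ 24) (map (\<lambda>j. orbit dyadic_row 0 j mod 16) [0..<66])"
    using next_row_funpow[of 24 16 dyadic_row 0 42] by simp
  also have "map (\<lambda>j. orbit dyadic_row 0 j mod 16) [0..<66] =
    [15, 0, 0, 15, 0, 1, 15, 2, 15, 0, 0, 1, 2, 0, 15, 0, 0, 2, 0, 14, 0, 15, 0, 0, 1, 12, 2, 1,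
     12, 3, 1, 14, 1, 2, 12, 3, 4, 12, 1, 2, 12, 4, 2, 10, 2, 1, 12, 2, 3, 8, 4, 3, 8, 5, 3, 10,
     3, 4, 8, 5, 6, 8, 3, 4, 8, 6]"
    by (simp add: dyadic_row_def delta_def upt_0_conv_Cons)
  also have "(next_row 16 ^^ 24) \<dots> =
    [5, 6, 12, 13, 6, 13, 5, 0, 11, 6, 6, 13, 8, 14, 11, 6, 14, 6, 14, 4, 4, 5, 14, 12, 7, 2, 14,
     15, 2, 15, 7, 12, 13, 8, 2, 15, 10, 10, 13, 8, 10, 8]"
    by (simp add: eval_nat_numeral)
  finally show ?thesis .
qed

lemma dyadic_row_orbit_48:
  "map (\<lambda>j. orbit dyadic_row 48 j mod 16) [0..<18] =
    [11, 12, 8, 11, 12, 9, 11, 14, 7, 12, 12, 9, 14, 12, 7, 12, 12, 10]"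
proof -
  have "map (\<lambda>j. orbit dyadic_row 48 j mod 16) [0..<18]
      = (next_row 16 ^^ 24) (map (\<lambda>j. orbit dyadic_row 24 j mod 16) [0..<42])"
    using next_row_funpow[of 24 16 dyadic_row 24 18] by simp
  also note dyadic_row_orbit_24
  also have "(next_row 16 ^^ 24)
    [5, 6, 12, 13, 6, 13, 5, 0, 11, 6, 6, 13, 8, 14, 11, 6, 14, 6, 14, 4, 4, 5, 14, 12, 7, 2, 14,
     15, 2, 15, 7, 12, 13, 8, 2, 15, 10, 10, 13, 8, 10, 8] =
    [11, 12, 8, 11, 12, 9, 11, 14, 7, 12, 12, 9, 14, 12, 7, 12, 12, 10]"
    by (simp add: eval_nat_numeral)
  finally show ?thesis .
qed

text \<open>These start the induction on powers of 2: \<open>(1 + E)^24 u\<close> is known modulo 8,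
  and \<open>((1 + E)^24 - 1)^2 u\<close> vanishes modulo 16. Both expressions satisfy the
  recurrence, so \<open>j < 18\<close> suffices.\<close>

lemma dyadic_row_orbit_24_dvd: "8 dvd orbit dyadic_row 24 j - dyadic_row j - 2 * orbit delta 1 j"
  and dyadic_row_orbit_48_dvd:
    "16 dvd orbit dyadic_row 48 j - 2 * orbit dyadic_row 24 j + dyadic_row j"
proof -
  define xs ys :: "int list" where
    "xs = [5, 6, 12, 13, 6, 13, 5, 0, 11, 6, 6, 13, 8, 14, 11, 6, 14, 6, 14, 4, 4, 5, 14, 12, 7, 2, 14,
     15, 2, 15, 7, 12, 13, 8, 2, 15, 10, 10, 13, 8, 10, 8]" and
    "ys = [11, 12, 8, 11, 12, 9, 11, 14, 7, 12, 12, 9, 14, 12, 7, 12, 12, 10]"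
  have x: "16 dvd orbit dyadic_row 24 j - xs ! j" if "j < 18" for j
  proof -
    have "orbit dyadic_row 24 j mod 16 = xs ! j"
      using arg_cong[OF dyadic_row_orbit_24, of "\<lambda>xs. xs ! j"] that by (simp add: xs_def)
    then show ?thesis by (metis mod_eq_dvd_iff mod_mod_trivial)
  qed
  have y: "16 dvd orbit dyadic_row 48 j - ys ! j" if "j < 18" for j
  proof -
    have "orbit dyadic_row 48 j mod 16 = ys ! j"
      using arg_cong[OF dyadic_row_orbit_48, of "\<lambda>xs. xs ! j"] that by (simp add: ys_def)
    then show ?thesis by (metis mod_eq_dvd_iff mod_mod_trivial)
  qed
  have "list_all (\<lambda>j. 8 dvd xs ! j - dyadic_row j - 2 * orbit delta 1 j \<and>
      16 dvd ys ! j - 2 * xs ! j + dyadic_row j) [0..<18]"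
    by (simp add: upt_0_conv_Cons dyadic_row_def delta_def xs_def ys_def)
  then have check: "8 dvd xs ! j - dyadic_row j - 2 * orbit delta 1 j \<and>
      16 dvd ys ! j - 2 * xs ! j + dyadic_row j" if "j < 18" for j
    using that unfolding list_all_iff set_upt by auto
  let ?X = "\<lambda>j. orbit dyadic_row 24 j - dyadic_row j - 2 * orbit delta 1 j"
  let ?Y = "\<lambda>j. orbit dyadic_row 48 j - 2 * orbit dyadic_row 24 j + dyadic_row j"
  have "sparse_rec (\<lambda>j. 1 * (1 * orbit dyadic_row 24 j + - 1 * dyadic_row j)
      + - 2 * orbit delta 1 j)"
    by (intro sparse_rec_linear sparse_rec_orbit sparse_rec_dyadic_row sparse_rec_delta)
  then have "sparse_rec ?X" by (simp del: orbit.simps)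
  then show "8 dvd ?X j"
  proof (rule sparse_rec_dvd)
    fix j :: nat assume "j < 18"
    then have "8 dvd (orbit dyadic_row 24 j - xs ! j) + (xs ! j - dyadic_row j - 2 * orbit delta 1 j)"
      using check by (intro dvd_add dvd_trans[OF _ x]) auto
    then show "8 dvd ?X j" by (simp add: algebra_simps del: orbit.simps)
  qed
  have "sparse_rec (\<lambda>j. 1 * (1 * orbit dyadic_row 48 j + - 2 * orbit dyadic_row 24 j)
      + 1 * dyadic_row j)"
    by (intro sparse_rec_linear sparse_rec_orbit sparse_rec_dyadic_row sparse_rec_delta)
  then have "sparse_rec ?Y" by (simp del: orbit.simps)
  then show "16 dvd ?Y j"
  proof (rule sparse_rec_dvd)
    fix j :: nat assume j: "j < 18"
    from dvd_add[OF dvd_diff[OF y[OF j] dvd_mult[OF x[OF j], of 2]] conjunct2[OF check[OF j]]]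
    show "16 dvd ?Y j" by (simp add: algebra_simps del: orbit.simps)
  qed
qed

text \<open>Put \<open>F = (1 + E)^N\<close> with \<open>N = 24 * 2^t\<close>; it fixes
  \<open>orbit delta 1\<close>. Applying \<open>F\<close> again doubles the \<open>delta\<close>
  term and replaces the error \<open>b \<rho>\<close> by \<open>b (\<rho> + F \<rho>)\<close>. As
  \<open>F \<rho> = \<rho> + 2 \<kappa>\<close>, this is \<open>2 b (\<rho> + \<kappa>)\<close>, so
  the error gains the required factor 2. Carrying the recurrence along makes the new error even
  under the next step, since \<open>2 N\<close> is a multiple of 48.\<close>

lemma dyadic_row_orbit_power:
  "\<exists>\<rho>. sparse_rec \<rho> \<and> (\<forall>j. even (orbit \<rho> (24 * 2 ^ t) j - \<rho> j)) \<and>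
     (\<forall>j. orbit dyadic_row (24 * 2 ^ t) j
            = dyadic_row j + 2 ^ (t + 1) * orbit delta 1 j + 2 ^ (t + 3) * \<rho> j)"
proof (induction t)
  case 0
  obtain \<rho> where \<rho>: "orbit dyadic_row 24 j - dyadic_row j - 2 * orbit delta 1 j = 8 * \<rho> j" for j
    using dyadic_row_orbit_24_dvd unfolding dvd_def by metis
  have "sparse_rec (\<lambda>j. 1 * (1 * orbit dyadic_row 24 j + - 1 * dyadic_row j)
      + - 2 * orbit delta 1 j)"
    by (intro sparse_rec_linear sparse_rec_orbit sparse_rec_dyadic_row sparse_rec_delta)
  then have "sparse_rec (\<lambda>j. 8 * \<rho> j)"
    by (simp add: \<rho>[symmetric] del: orbit.simps)
  then have rec: "sparse_rec \<rho>" by (rule sparse_rec_cancel) simp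
  have eq: "orbit dyadic_row 24 = (\<lambda>j. 1 * dyadic_row j + 1 * (2 * orbit delta 1 j + 8 * \<rho> j))"
    using \<rho> by (auto simp del: orbit.simps simp: algebra_simps)
  have "even (orbit \<rho> 24 j - \<rho> j)" for j
  proof -
    have "orbit dyadic_row 48 j = orbit (orbit dyadic_row 24) 24 j" by (simp add: orbit_orbit)
    also have "\<dots> = orbit dyadic_row 24 j + (2 * orbit delta (1 + 24) j + 8 * orbit \<rho> 24 j)"
      by (subst eq) (simp only: orbit_linear orbit_orbit, simp only: mult_1 add.commute[of 24 1])
    also have "orbit delta (1 + 24) j = orbit delta 1 j" by (rule orbit_delta_add) simp
    finally have "orbit dyadic_row 48 j - 2 * orbit dyadic_row 24 j + dyadic_row j
        = 8 * (orbit \<rho> 24 j - \<rho> j)"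
      using \<rho>[of j] by (simp add: algebra_simps del: orbit.simps)
    with dyadic_row_orbit_48_dvd[of j] have "8 * 2 dvd 8 * (orbit \<rho> 24 j - \<rho> j)" by simp
    then show ?thesis by (simp only: dvd_mult_cancel_left) simp
  qed
  then show ?case using rec \<rho> by (intro exI[of _ \<rho>]) (simp del: orbit.simps add: algebra_simps)
next
  case (Suc t)
  define N :: nat where "N = 24 * 2 ^ t"
  define a b :: int where "a = 2 ^ (t + 1)" and "b = 2 ^ (t + 3)"
  from Suc obtain \<rho> where rec: "sparse_rec \<rho>" and ev: "\<And>j. even (orbit \<rho> N j - \<rho> j)"
    and \<rho>: "\<And>j. orbit dyadic_row N j = dyadic_row j + a * orbit delta 1 j + b * \<rho> j"
    unfolding N_def a_def b_def by auto
  obtain \<kappa> where \<kappa>: "\<And>j. orbit \<rho> N j - \<rho> j = 2 * \<kappa> j"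
    using ev unfolding dvd_def by metis
  have "sparse_rec (\<lambda>j. 1 * orbit \<rho> N j + - 1 * \<rho> j)"
    by (intro sparse_rec_linear sparse_rec_orbit rec)
  then have "sparse_rec (\<lambda>j. 2 * \<kappa> j)" by (simp add: \<kappa>[symmetric])
  then have "sparse_rec \<kappa>" by (rule sparse_rec_cancel) simp
  then have rec': "sparse_rec (\<lambda>j. 1 * \<rho> j + 1 * \<kappa> j)"
    by (intro sparse_rec_linear rec)
  have eq: "orbit dyadic_row N = (\<lambda>j. 1 * dyadic_row j + 1 * (a * orbit delta 1 j + b * \<rho> j))"
    using \<rho> by (auto simp del: orbit.simps simp: algebra_simps)
  have "orbit dyadic_row (24 * 2 ^ Suc t) j
      = dyadic_row j + 2 ^ (Suc t + 1) * orbit delta 1 j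
        + 2 ^ (Suc t + 3) * (1 * \<rho> j + 1 * \<kappa> j)" for j
  proof -
    have "orbit dyadic_row (24 * 2 ^ Suc t) j = orbit (orbit dyadic_row N) N j"
      by (simp add: orbit_orbit N_def)
    also have "\<dots> = orbit dyadic_row N j + (a * orbit delta (1 + N) j + b * orbit \<rho> N j)"
      by (subst eq) (simp only: orbit_linear orbit_orbit, simp only: mult_1 add.commute[of N 1])
    also have "orbit delta (1 + N) j = orbit delta 1 j" by (rule orbit_delta_add) (simp add: N_def)
    also have "b * orbit \<rho> N j = b * \<rho> j + b * (2 * \<kappa> j)"
      using \<kappa>[of j] by (simp add: distrib_left[symmetric])
    finally show ?thesis unfolding \<rho> by (simp add: a_def b_def algebra_simps power_add del: orbit.simps)
  qed
  moreover have "even (orbit (\<lambda>j. 1 * \<rho> j + 1 * \<kappa> j) (24 * 2 ^ Suc t) j - (1 * \<rho> j + 1 * \<kappa> j))" for j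
    using sparse_rec_orbit_48_even[OF rec', of "2 ^ t" j] by (simp add: mult.assoc[symmetric])
  ultimately show ?case using rec' by blast
qed

lemma dyadic_row_grid:
  "[orbit dyadic_row (r + 24 * 2 ^ t * I) (s + 24 * 2 ^ t * J) = orbit dyadic_row r s
     + 2 ^ (t + 1) * (int I * orbit delta (Suc r) s + int J * orbit delta r s)] (mod 2 ^ (t + 3))"
proof (rule orbit_grid)
  obtain \<rho> where "orbit dyadic_row (24 * 2 ^ t) j
      = dyadic_row j + 2 ^ (t + 1) * orbit delta 1 j + 2 ^ (t + 3) * \<rho> j" for j
    using dyadic_row_orbit_power[of t] by blast
  then show "[orbit dyadic_row (24 * 2 ^ t) j = dyadic_row j + 2 ^ (t + 1) * orbit delta 1 j]
      (mod 2 ^ (t + 3))" for j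
    by (simp add: cong_iff_dvd_diff del: orbit.simps)
  show "dyadic_row (j + 24 * 2 ^ t) = dyadic_row j + 2 ^ (t + 1) * delta j" for j
    using dyadic_row_add[of j "2 ^ t"] by simp
qed simp

lemma dyadic_row_periodic:
  "[orbit dyadic_row (r + 24 * 2 ^ t * I) (s + 24 * 2 ^ t * J) = orbit dyadic_row r s]
     (mod 2 ^ (t + 1))"
proof -
  let ?e = "int I * orbit delta (Suc r) s + int J * orbit delta r s"
  have "[orbit dyadic_row (r + 24 * 2 ^ t * I) (s + 24 * 2 ^ t * J)
      = orbit dyadic_row r s + 2 ^ (t + 1) * ?e] (mod 2 ^ (t + 1))"
    using dyadic_row_grid[of r t I s J] by (rule cong_dvd_modulus) (rule le_imp_power_dvd, simp)
  also have "[orbit dyadic_row r s + 2 ^ (t + 1) * ?e = orbit dyadic_row r s] (mod 2 ^ (t + 1))"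
    by (simp add: cong_iff_dvd_diff del: orbit.simps)
  finally show ?thesis .
qed

subsection \<open>Triangular sums\<close>

lemma finite_tri_idx: "finite (tri_idx n)"
proof -
  have "tri_idx n \<subseteq> {..<n} \<times> {..<n}" by (auto simp: tri_idx_def)
  then show ?thesis by (rule finite_subset) simp
qed

lemma sum_tri_idx:
  "(\<Sum>(i, j)\<in>tri_idx n. f i j) = (\<Sum>i<n. \<Sum>j<n - i. f i j)"
proof -
  have "tri_idx n = Sigma {..<n} (\<lambda>i. {..<n - i})" by (auto simp: tri_idx_def)
  then show ?thesis by (simp add: sum.Sigma)
qed

text \<open>Offset \<open>(r, s)\<close> in block \<open>(I, J)\<close> lies in the triangle iff
  \<open>N * (I + J) + r + s < N * M\<close>. For \<open>r + s < N\<close> this means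
  \<open>I + J < M\<close>; for \<open>N \<le> r + s < 2 * N\<close> it means
  \<open>I + J < M - 1\<close>.\<close>

lemma sum_tri_idx_blocks:
  fixes f :: "nat \<Rightarrow> nat \<Rightarrow> 'a::comm_monoid_add"
  assumes "N > 0"
  shows "(\<Sum>(i, j)\<in>tri_idx (N * M). f i j) = (\<Sum>(r, s)\<in>{..<N} \<times> {..<N}.
    \<Sum>(I, J)\<in>tri_idx (if r + s < N then M else M - 1). f (r + N * I) (s + N * J))"
proof -
  let ?B = "\<lambda>(r, s). tri_idx (if r + s < N then M else M - 1)"
  have "(\<Sum>(i, j)\<in>tri_idx (N * M). f i j) = (\<Sum>((r, s), (I, J))\<in>Sigma ({..<N} \<times> {..<N}) ?B.
      f (r + N * I) (s + N * J))"
  proof (rule sum.reindex_bij_witness[where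
        i = "\<lambda>((r, s), (I, J)). (r + N * I, s + N * J)" and
        j = "\<lambda>(i, j). ((i mod N, j mod N), (i div N, j div N))"], goal_cases)
    case (1 a)
    show ?case by (cases a) simp
  next
    case (2 a)
    obtain i j where a: "a = (i, j)" by fastforce
    define r s I J where "r = i mod N" "s = j mod N" "I = i div N" "J = j div N"
    have ij: "i = r + N * I" "j = s + N * J" by (simp_all add: r_s_I_J_def)
    have rs: "r < N" "s < N" using assms by (simp_all add: r_s_I_J_def)
    have less: "N * (I + J) + (r + s) < N * M"
      using 2 by (simp add: a tri_idx_def ij algebra_simps)
    then have "N * (I + J) < N * M" by linarith
    then have 1: "I + J < M" by simp
    have 2: "I + J < M - 1" if "N \<le> r + s"
    proof -
      have "N * (I + J + 1) < N * M"
        using less that by simp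
      then have "I + J + 1 < M" by (metis nat_mult_less_cancel_disj)
      then show ?thesis by simp
    qed
    show ?case using 1 2 rs by (auto simp: a tri_idx_def r_s_I_J_def)
  next
    case (3 b)
    then show ?case using assms by auto
  next
    case (4 b)
    obtain r s I J where b: "b = ((r, s), (I, J))" by (metis surj_pair)
    have rs: "r < N" "s < N" using 4 by (auto simp: b)
    have "N * (I + J) + (r + s) < N * M"
    proof (cases "r + s < N")
      case True
      then have "I + J + 1 \<le> M" using 4 by (auto simp: b tri_idx_def)
      then have "N * (I + J + 1) \<le> N * M" by (rule mult_le_mono2)
      then show ?thesis using True by simp
    next
      case False
      then have "I + J + 2 \<le> M" using 4 by (auto simp: b tri_idx_def)
      then have "N * (I + J + 2) \<le> N * M" by (rule mult_le_mono2)
      then show ?thesis using rs by simp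
    qed
    then show ?case by (simp add: b tri_idx_def algebra_simps)
  next
    case (5 a)
    show ?case by (cases a) simp
  qed
  then show ?thesis
    by (simp add: sum.Sigma finite_tri_idx split_def)
qed

text \<open>Summing over \<open>J\<close> first leaves geometric sums in \<open>C / D\<close> and in
  \<open>C\<close>, both over full periods and hence zero.\<close>

lemma sum_tri_idx_geometric:
  fixes C D :: complex
  assumes "C \<noteq> 1" "D \<noteq> 1" "C \<noteq> D" "C ^ M = 1" "D ^ M = 1"
  shows "(\<Sum>(I, J)\<in>tri_idx M. C ^ I * D ^ J) = 0"
    and "(\<Sum>(I, J)\<in>tri_idx (M - 1). C ^ I * D ^ J) = 0"
proof -
  have *: "(\<Sum>(I, J)\<in>tri_idx K. C ^ I * D ^ J) = ((\<Sum>I<K. C ^ I * D ^ (K - I)) - (\<Sum>I<K. C ^ I)) / (D - 1)"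
    for K
    using \<open>D \<noteq> 1\<close>
    by (simp add: sum_tri_idx sum_distrib_left[symmetric] geometric_sum sum_subtractf[symmetric]
        sum_divide_distrib right_diff_distrib)
  show "(\<Sum>(I, J)\<in>tri_idx M. C ^ I * D ^ J) = 0 " and "(\<Sum>(I, J)\<in>tri_idx (M - 1). C ^ I * D ^ J) = 0"
  proof (atomize (full), cases "M = 0")
    case True
    then show "(\<Sum>(I, J)\<in>tri_idx M. C ^ I * D ^ J) = 0 \<and> (\<Sum>(I, J)\<in>tri_idx (M - 1). C ^ I * D ^ J) = 0"
      by (simp add: tri_idx_def)
  next
    case False
    have D0: "D \<noteq> 0" using False \<open>D ^ M = 1\<close> by (metis power_0_left zero_neq_one)
    have "(C / D) ^ M = 1" "C / D \<noteq> 1" using assms D0 by (simp_all add: power_divide)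
    then have CD: "(\<Sum>I<M. (C / D) ^ I) = 0" by (simp add: geometric_sum)
    have C: "(\<Sum>I<M. C ^ I) = 0" using assms by (simp add: geometric_sum)
    have D: "D ^ (M - I) = (1 / D) ^ I" if "I < M" for I
    proof -
      have "D ^ (M - I) * D ^ I = 1" using that \<open>D ^ M = 1\<close> by (simp flip: power_add)
      then show ?thesis using D0 by (simp add: field_simps)
    qed
    have E: "C ^ I * D ^ (M - I) = (C / D) ^ I" if "I < M" for I
      using D[OF that] by (simp add: power_divide)
    have "(\<Sum>I<M. C ^ I * D ^ (M - I)) = 0"
      using CD E by simp
    then have 1: "(\<Sum>(I, J)\<in>tri_idx M. C ^ I * D ^ J) = 0" using C by (simp add: *)
    obtain K where K: "M = Suc K" using False by (cases M) auto
    \<comment> \<open>Both sums are extended to the full period: the new terms at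
      \<open>I = K\<close> are both \<open>C ^ K\<close> and cancel.\<close>
    have "(\<Sum>I<K. C ^ I * D ^ (K - I)) - (\<Sum>I<K. C ^ I)
        = (\<Sum>I<M. C ^ I * D ^ (K - I)) - (\<Sum>I<M. C ^ I)"
      by (simp add: K)
    also have "(\<Sum>I<M. C ^ I * D ^ (K - I)) = (\<Sum>I<M. (C / D) ^ I / D)"
    proof (rule sum.cong)
      fix I assume "I \<in> {..<M}"
      then have "M - I = Suc (K - I)" by (simp add: K Suc_diff_le)
      then show "C ^ I * D ^ (K - I) = (C / D) ^ I / D"
        using E[of I] \<open>I \<in> {..<M}\<close> D0 by (simp add: field_simps)
    qed simp
    also have "\<dots> - (\<Sum>I<M. C ^ I) = 0"
      using CD C by (simp add: sum_divide_distrib[symmetric])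
    finally have "(\<Sum>(I, J)\<in>tri_idx K. C ^ I * D ^ J) = 0" by (simp add: *)
    with 1 show "(\<Sum>(I, J)\<in>tri_idx M. C ^ I * D ^ J) = 0 \<and> (\<Sum>(I, J)\<in>tri_idx (M - 1). C ^ I * D ^ J) = 0"
      by (simp add: K)
  qed
qed

text \<open>The exponent is one of 1, -1, 2, -2, and each would force
  \<open>x\<^sup>2 = 1\<close>.\<close>

lemma powi_delta_neq_1:
  fixes x :: complex
  assumes "x\<^sup>2 \<noteq> 1"
  shows "x powi orbit delta i j \<noteq> 1"
  using orbit_delta_values[of i j] assms
  by (auto simp: power_int_minus power2_eq_square power_int_def nat_numeral
      simp flip: inverse_mult_distrib)

lemma sum_tri_idx_delta_grid:
  fixes x :: complex and f :: "nat \<Rightarrow> nat \<Rightarrow> complex"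
  assumes f: "\<And>r s I J. f (r + N * I) (s + N * J)
        = f r s * x powi (int I * orbit delta (Suc r) s + int J * orbit delta r s)"
    and "x\<^sup>2 \<noteq> 1" "x ^ M = 1" "N > 0"
  shows "(\<Sum>(i, j)\<in>tri_idx (N * M). f i j) = 0"
proof (cases "M = 0")
  case False
  have x0: "x \<noteq> 0" using False \<open>x ^ M = 1\<close> by (metis power_0_left zero_neq_one)
  have zero: "(\<Sum>(I, J)\<in>tri_idx (if r + s < N then M else M - 1). f (r + N * I) (s + N * J)) = 0"
    for r s
  proof -
    define C D where "C = x powi orbit delta (Suc r) s" and "D = x powi orbit delta r s"
    have C: "C \<noteq> 1" and D: "D \<noteq> 1"
      unfolding C_def D_def using powi_delta_neq_1[OF \<open>x\<^sup>2 \<noteq> 1\<close>] by blast+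
    \<comment> \<open>By the Pascal rule the ratio \<open>C / D\<close> is again a power of
      \<open>x\<close> with an exponent from \<open>orbit delta\<close>, hence differs from
      1.\<close>
    have "C = D * x powi orbit delta r (Suc s)"
      using x0 by (simp add: C_def D_def power_int_add)
    moreover have "D \<noteq> 0" using x0 by (simp add: D_def)
    ultimately have CD: "C \<noteq> D"
      using powi_delta_neq_1[OF \<open>x\<^sup>2 \<noteq> 1\<close>, of r "Suc s"] by auto
    have pow: "(x powi a) ^ M = 1" for a
      using \<open>x ^ M = 1\<close> by (metis mult.commute power_int_1_left power_int_mult power_int_of_nat)
    have fCD: "f (r + N * I) (s + N * J) = f r s * (C ^ I * D ^ J)" for I J
      using x0 by (simp add: f C_def D_def power_int_add power_int_mult power_int_of_nat
          mult.commute[of "int _"] del: orbit.simps)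
    show ?thesis
      unfolding fCD
      using sum_tri_idx_geometric[OF C D CD, of M] pow
      by (simp add: C_def D_def split_def sum_distrib_left[symmetric] del: orbit.simps)
  qed
  show ?thesis
    unfolding sum_tri_idx_blocks[OF \<open>N > 0\<close>] using zero by (simp add: split_def)
qed (simp add: tri_idx_def)

text \<open>With \<open>f\<close> periodic, every block contributes the same lower and upper part,
  so the sum is a combination of two unknowns. Size \<open>N\<close> gives \<open>lower = 0\<close>,
  and size \<open>2 * N\<close> then gives \<open>upper = 0\<close>.\<close>

lemma sum_tri_idx_periodic:
  fixes f :: "nat \<Rightarrow> nat \<Rightarrow> complex"
  assumes f: "\<And>r s I J. f (r + N * I) (s + N * J) = f r s"
    and "N > 0" and 1: "(\<Sum>(i, j)\<in>tri_idx N. f i j) = 0"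
    and 2: "(\<Sum>(i, j)\<in>tri_idx (2 * N). f i j) = 0"
  shows "(\<Sum>(i, j)\<in>tri_idx (N * M). f i j) = 0"
proof -
  define lower upper where
    "lower = (\<Sum>(r, s)\<in>{..<N} \<times> {..<N}. if r + s < N then f r s else 0)" and
    "upper = (\<Sum>(r, s)\<in>{..<N} \<times> {..<N}. if r + s < N then 0 else f r s)"
  have *: "(\<Sum>(i, j)\<in>tri_idx (N * K). f i j)
      = of_nat (card (tri_idx K)) * lower + of_nat (card (tri_idx (K - 1))) * upper" for K
  proof -
    have "(\<Sum>(i, j)\<in>tri_idx (N * K). f i j) = (\<Sum>(r, s)\<in>{..<N} \<times> {..<N}.
        of_nat (card (tri_idx K)) * (if r + s < N then f r s else 0)
        + of_nat (card (tri_idx (K - 1))) * (if r + s < N then 0 else f r s))"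
      unfolding sum_tri_idx_blocks[OF \<open>N > 0\<close>] f by (intro sum.cong) (auto simp: split_def)
    then show ?thesis
      by (simp add: lower_def upper_def split_def sum.distrib sum_distrib_left)
  qed
  have "tri_idx 0 = {}" "tri_idx 1 = {(0, 0)}" by (auto simp: tri_idx_def)
  with *[of 1] 1 have "lower = 0" by simp
  with *[of 2] 2 \<open>tri_idx 1 = {(0, 0)}\<close> have "upper = 0" by (simp add: mult.commute)
  with \<open>lower = 0\<close> show ?thesis by (simp add: *)
qed

subsection \<open>Character sums\<close>

fun bump :: "int \<Rightarrow> int \<times> int \<times> int \<times> int \<Rightarrow> int \<times> int \<times> int \<times> int" where
  "bump x (a, b, c, d) =
     (if x = 0 then (a + 1, b, c, d) else if x = 1 then (a, b + 1, c, d)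
      else if x = 2 then (a, b, c + 1, d) else (a, b, c, d + 1))"

primrec triangle_tally ::
    "nat \<Rightarrow> int list \<Rightarrow> int \<times> int \<times> int \<times> int \<Rightarrow> int \<times> int \<times> int \<times> int" where
  "triangle_tally 0 xs t = t"
| "triangle_tally (Suc n) xs t = triangle_tally n (next_row 4 xs) (fold bump xs t)"

text \<open>Since 73 + 77 = 82 + 68, even and odd entries are equally frequent, as the character of
  order 2 requires.\<close>

lemma tally_triangle_24:
  "triangle_tally 24 (map (\<lambda>j. dyadic_row j mod 4) [0..<24]) (0, 0, 0, 0) = (73, 82, 77, 68)"
proof -
  have "map (\<lambda>j. dyadic_row j mod 4) [0..<24] =
    [3, 0, 0, 3, 0, 1, 3, 2, 3, 0, 0, 1, 2, 0, 3, 0, 0, 2, 0, 2, 0, 3, 0, 0]"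
    by (simp add: dyadic_row_def delta_def upt_0_conv_Cons)
  then show ?thesis by (simp only:) (simp add: eval_nat_numeral)
qed

text \<open>Size 48 is two periods modulo 2 and one period modulo 4, so this count serves both
  orders.\<close>

lemma tally_triangle_48:
  "triangle_tally 48 (map (\<lambda>j. dyadic_row j mod 4) [0..<48]) (0, 0, 0, 0) = (294, 294, 294, 294)"
proof -
  have "map (\<lambda>j. dyadic_row j mod 4) [0..<48] =
    [3, 0, 0, 3, 0, 1, 3, 2, 3, 0, 0, 1, 2, 0, 3, 0, 0, 2, 0, 2, 0, 3, 0, 0, 1, 0, 2, 1, 0, 3, 1, 2,
     1, 2, 0, 3, 0, 0, 1, 2, 0, 0, 2, 2, 2, 1, 0, 2]"
    by (simp add: dyadic_row_def delta_def upt_0_conv_Cons)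
  then show ?thesis by (simp only:) (simp add: eval_nat_numeral)
qed

lemma tally_triangle_96:
  "triangle_tally 96 (map (\<lambda>j. dyadic_row j mod 4) [0..<96]) (0, 0, 0, 0) = (1164, 1164, 1164, 1164)"
proof -
  have "map (\<lambda>j. dyadic_row j mod 4) [0..<96] =
    [3, 0, 0, 3, 0, 1, 3, 2, 3, 0, 0, 1, 2, 0, 3, 0, 0, 2, 0, 2, 0, 3, 0, 0, 1, 0, 2, 1, 0, 3, 1, 2,
     1, 2, 0, 3, 0, 0, 1, 2, 0, 0, 2, 2, 2, 1, 0, 2, 3, 0, 0, 3, 0, 1, 3, 2, 3, 0, 0, 1, 2, 0, 3, 0,
     0, 2, 0, 2, 0, 3, 0, 0, 1, 0, 2, 1, 0, 3, 1, 2, 1, 2, 0, 3, 0, 0, 1, 2, 0, 0, 2, 2, 2, 1, 0, 2]"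
    by (simp add: dyadic_row_def delta_def upt_0_conv_Cons)
  then show ?thesis by (simp only:) (simp add: eval_nat_numeral)
qed

section \<open>Evaluating characters on the triangle\<close>

lemma powi_cong:
  fixes p :: complex
  assumes "[a = b] (mod int K)" "p ^ K = 1" "K > 0"
  shows "p powi a = p powi b"
proof -
  obtain c where c: "a = b + int K * c"
    using assms(1) by (metis cong_iff_lin cong_sym)
  have "p \<noteq> 0" using assms by (metis power_0_left zero_neq_one less_numeral_extra(3))
  then show ?thesis using assms by (simp add: c power_int_add power_int_mult)
qed

lemma power_coprime_eq_1:
  fixes p :: complex
  assumes "p ^ a = 1" "p ^ b = 1" "coprime a b" "a > 0"
  shows "p = 1"
proof -
  obtain x y where "a * x = b * y + 1"
    using bezout_nat[of a b] assms by auto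
  then have "(p ^ a) ^ x = (p ^ b) ^ y * p"
    by (metis power_add power_mult power_one_right)
  then show ?thesis using assms by simp
qed

text \<open>A tally \<open>(a, b, c, d)\<close> counts the residues 0, 1, 2, 3 modulo 4; \<open>bump\<close> files every other
  number under 3.\<close>

definition tally_value :: "complex \<Rightarrow> int \<times> int \<times> int \<times> int \<Rightarrow> complex" where
  "tally_value p t = (case t of (a, b, c, d) \<Rightarrow>
     of_int a + of_int b * p + of_int c * p\<^sup>2 + of_int d * p ^ 3)"

lemma tally_value_fold_bump:
  assumes "set xs \<subseteq> {0..<4}"
  shows "tally_value p (fold bump xs t) = tally_value p t + (\<Sum>x\<leftarrow>xs. p powi x)"
  using assms
proof (induction xs arbitrary: t)
  case (Cons x xs)
  obtain a b c d where t: "t = (a, b, c, d)" by (metis surj_pair)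
  have "x = 0 \<or> x = 1 \<or> x = 2 \<or> x = 3" using Cons.prems by auto
  then have "tally_value p (bump x t) = tally_value p t + p powi x"
    by (auto simp: t tally_value_def algebra_simps power_int_def nat_numeral)
  then show ?case using Cons by simp
qed simp

lemma tally_value_triangle:
  assumes "p ^ 4 = 1"
  shows "tally_value p (triangle_tally n (map (\<lambda>j. f j mod 4) [0..<n]) t)
    = tally_value p t + (\<Sum>(i, j)\<in>tri_idx n. p powi orbit f i j)"
proof (induction n arbitrary: f t)
  case 0
  then show ?case by (simp add: tri_idx_def)
next
  case (Suc n)
  have mod4: "p powi (a mod 4) = p powi a" for a
    by (rule powi_cong[of _ _ 4]) (use assms in \<open>simp_all add: cong_def\<close>)
  have "(\<Sum>x\<leftarrow>map (\<lambda>j. f j mod 4) [0..<Suc n]. p powi x) = (\<Sum>j<Suc n. p powi f j)"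
    unfolding map_map comp_def mod4 by (simp only: interv_sum_list_conv_sum_set_nat atLeast0LessThan set_upt)
  moreover have "next_row 4 (map (\<lambda>j. f j mod 4) [0..<Suc n]) = map (\<lambda>j. orbit f 1 j mod 4) [0..<n]"
    using next_row_orbit[of 4 f 0 n] by (simp del: upt_Suc)
  moreover have "set (map (\<lambda>j. f j mod 4) [0..<Suc n]) \<subseteq> {0..<4}" by auto
  ultimately have "tally_value p (triangle_tally (Suc n) (map (\<lambda>j. f j mod 4) [0..<Suc n]) t)
      = tally_value p t + (\<Sum>j<Suc n. p powi f j)
        + (\<Sum>(i, j)\<in>tri_idx n. p powi orbit (orbit f 1) i j)"
    by (simp only: triangle_tally.simps Suc tally_value_fold_bump)
  also have "(\<Sum>(i, j)\<in>tri_idx n. p powi orbit (orbit f 1) i j)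
      = (\<Sum>i<n. \<Sum>j<n - i. p powi orbit f (Suc i) j)"
    by (simp only: sum_tri_idx orbit_orbit) simp
  also have "(\<Sum>j<Suc n. p powi f j) = (\<Sum>j<Suc n - 0. p powi orbit f 0 j)" by simp
  finally show ?case
    by (simp only: sum_tri_idx sum.lessThan_Suc_shift diff_Suc_Suc add.assoc)
qed

lemma dyadic_row_sum_tri_idx:
  fixes p :: complex
  assumes "p ^ 4 = 1" "p \<noteq> 1"
  shows "p\<^sup>2 = 1 \<Longrightarrow> (\<Sum>(i, j)\<in>tri_idx 24. p powi orbit dyadic_row i j) = 0"
    and "(\<Sum>(i, j)\<in>tri_idx 48. p powi orbit dyadic_row i j) = 0"
    and "(\<Sum>(i, j)\<in>tri_idx 96. p powi orbit dyadic_row i j) = 0"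
proof -
  have "(p - 1) * (1 + p + p\<^sup>2 + p ^ 3) = 0"
    using assms(1) by (simp add: algebra_simps power2_eq_square power3_eq_cube power4_eq_xxxx)
  then have zero: "1 + p + p\<^sup>2 + p ^ 3 = 0" using assms(2) by simp
  have geo: "a + a * p + a * p\<^sup>2 + a * p ^ 3 = 0" for a
    using arg_cong[OF zero, of "\<lambda>x. a * x"] by (simp add: distrib_left)
  note tri = tally_value_triangle[OF assms(1), of _ dyadic_row "(0, 0, 0, 0)"]
  show "(\<Sum>(i, j)\<in>tri_idx 24. p powi orbit dyadic_row i j) = 0" if "p\<^sup>2 = 1"
  proof -
    have "p = - 1" using that assms(2) by (simp add: power2_eq_1_iff)
    then show ?thesis using tri[of 24] unfolding tally_triangle_24 by (simp add: tally_value_def)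
  qed
  show "(\<Sum>(i, j)\<in>tri_idx 48. p powi orbit dyadic_row i j) = 0"
    using tri[of 48] geo[of 294] unfolding tally_triangle_48 by (simp add: tally_value_def)
  show "(\<Sum>(i, j)\<in>tri_idx 96. p powi orbit dyadic_row i j) = 0"
    using tri[of 96] geo[of 1164] unfolding tally_triangle_96 by (simp add: tally_value_def)
qed

text \<open>The exact order \<open>2 ^ s\<close> of \<open>p\<close> decides the method: double
  geometric sums for \<open>s \<ge> 3\<close>, computed triangles for \<open>s = 1\<close> and
  \<open>s = 2\<close>.\<close>

lemma dyadic_char_sum:
  fixes p :: complex
  assumes "p \<noteq> 1" "p ^ 2 ^ k = 1"
  shows "(\<Sum>(i, j)\<in>tri_idx (12 * 2 ^ k * M). p powi orbit dyadic_row i j) = 0"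
proof -
  define s where "s = (LEAST s. p ^ 2 ^ s = 1)"
  have s: "p ^ 2 ^ s = 1" unfolding s_def by (rule LeastI) fact
  have sk: "s \<le> k" unfolding s_def by (rule Least_le) fact
  have min: "p ^ 2 ^ t \<noteq> 1" if "t < s" for t
    using that unfolding s_def by (rule not_less_Least)
  have "s \<noteq> 0" using s assms by (metis power_0 power_one_right)
  have p0: "p \<noteq> 0" using s by (metis power_0_left zero_neq_one power_not_zero zero_neq_numeral)
  show ?thesis
  proof (cases "s \<ge> 3")
    case True
    then obtain t where t: "s = t + 3" by (metis add.commute le_Suc_ex)
    \<comment> \<open>Minimality of \<open>s\<close> gives \<open>x\<close> order exactly 4, so
      \<open>x\<^sup>2 \<noteq> 1\<close>. The step \<open>24 * 2 ^ t\<close> is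
      \<open>3 * 2 ^ s\<close>, and the number of steps in the side is a multiple of 4.\<close>
    define x where "x = p ^ 2 ^ (t + 1)"
    have "(\<Sum>(i, j)\<in>tri_idx (24 * 2 ^ t * (4 * 2 ^ (k - s) * M)). p powi orbit dyadic_row i j) = 0"
    proof (rule sum_tri_idx_delta_grid)
      show "x\<^sup>2 \<noteq> 1"
        using min[of "t + 2"] by (simp add: x_def t power_mult[symmetric] mult.commute)
      have "x ^ 4 = 1"
        using s by (simp add: x_def t power_mult[symmetric] power_add mult.commute)
      then show "x ^ (4 * 2 ^ (k - s) * M) = 1" by (simp add: power_mult)
      fix r s' I J
      let ?e = "int I * orbit delta (Suc r) s' + int J * orbit delta r s'"
      have "p powi orbit dyadic_row (r + 24 * 2 ^ t * I) (s' + 24 * 2 ^ t * J)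
          = p powi (orbit dyadic_row r s' + 2 ^ (t + 1) * ?e)"
        using dyadic_row_grid[of r t I s' J] s
        by (intro powi_cong[of _ _ "2 ^ (t + 3)"]) (simp_all add: t del: orbit.simps)
      also have "\<dots> = p powi orbit dyadic_row r s' * (p powi int (2 ^ (t + 1))) powi ?e"
        using p0 by (simp add: power_int_add power_int_mult del: orbit.simps power_int_of_nat)
      also have "p powi int (2 ^ (t + 1)) = x" unfolding x_def by (rule power_int_of_nat)
      finally show "p powi orbit dyadic_row (r + 24 * 2 ^ t * I) (s' + 24 * 2 ^ t * J)
          = p powi orbit dyadic_row r s' * x powi ?e" .
    qed simp
    moreover have "2 ^ k = 2 ^ t * (8::nat) * 2 ^ (k - s)"
    proof -
      obtain l where "k = s + l" using sk le_Suc_ex by blast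
      then show ?thesis by (simp add: t power_add)
    qed
    ultimately show ?thesis by (simp add: algebra_simps)
  next
    case False
    then have p4: "p ^ 4 = 1"
    proof -
      have "s = 1 \<or> s = 2" using False \<open>s \<noteq> 0\<close> by auto
      then show ?thesis using s by (auto simp: power4_eq_xxxx power2_eq_square mult.assoc)
    qed
    have per: "p powi orbit dyadic_row (r + 24 * 2 ^ t * I) (s' + 24 * 2 ^ t * J)
        = p powi orbit dyadic_row r s'" if "p ^ 2 ^ (t + 1) = 1" for t r s' I J
      using dyadic_row_periodic[of r t I s' J] that
      by (intro powi_cong[of _ _ "2 ^ (t + 1)"]) simp_all
    show ?thesis
    \<comment> \<open>For \<open>k \<ge> 2\<close> the size is a multiple of 48, the period for both
      remaining orders. For \<open>k = 1\<close> it is only known to be a multiple of 24, but then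
      \<open>p\<close> has order 2, with period 24.\<close>
    proof (cases "k \<ge> 2")
      case True
      then obtain l where k: "k = l + 2" by (metis add.commute le_Suc_ex)
      have "(\<Sum>(i, j)\<in>tri_idx (48 * (2 ^ l * M)). p powi orbit dyadic_row i j) = 0"
      proof (rule sum_tri_idx_periodic)
        show "p powi orbit dyadic_row (r + 48 * I) (s' + 48 * J) = p powi orbit dyadic_row r s'"
          for r s' I J
          using per[of 1 r I s' J] p4 by simp
      qed (use dyadic_row_sum_tri_idx[OF p4 \<open>p \<noteq> 1\<close>] in simp_all)
      then show ?thesis by (simp add: k power_add algebra_simps)
    next
      case False
      then have k: "k = 1" using sk \<open>s \<noteq> 0\<close> by simp
      have p2: "p\<^sup>2 = 1" using assms k by simp
      have "(\<Sum>(i, j)\<in>tri_idx (24 * M). p powi orbit dyadic_row i j) = 0"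
      proof (rule sum_tri_idx_periodic)
        show "p powi orbit dyadic_row (r + 24 * I) (s' + 24 * J) = p powi orbit dyadic_row r s'"
          for r s' I J
          using per[of 0 r I s' J] p2 by simp
      qed (use dyadic_row_sum_tri_idx[OF p4 \<open>p \<noteq> 1\<close>] p2 in simp_all)
      then show ?thesis by (simp add: k)
    qed
  qed
qed

text \<open>With step \<open>12 * 2 ^ k\<close> the dyadic factor is periodic, so only
  \<open>z\<close> yields increments, as powers of \<open>z ^ (4 * 2 ^ k)\<close>. The square of
  this base differs from 1 because \<open>q\<close> is odd.\<close>

lemma mixed_char_sum:
  fixes p z :: complex
  assumes "p ^ 2 ^ k = 1" "z ^ q = 1" "z \<noteq> 1" "odd q"
  shows "(\<Sum>(i, j)\<in>tri_idx (12 * 2 ^ k * (q * M)).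
    p powi orbit dyadic_row i j * z powi orbit odd_row i j) = 0"
proof (rule sum_tri_idx_delta_grid)
  have z0: "z \<noteq> 0" using assms by (metis odd_pos power_0_left zero_neq_one less_numeral_extra(3))
  have "coprime (2 ^ (k + 3)) q" using \<open>odd q\<close> by simp
  then have "coprime (8 * 2 ^ k) q" by (simp add: power_add mult.commute)
  then show "(z ^ (4 * 2 ^ k))\<^sup>2 \<noteq> 1"
    using power_coprime_eq_1[of z "8 * 2 ^ k" q] assms
    by (auto simp: power_mult[symmetric] mult.commute mult.assoc)
  show "(z ^ (4 * 2 ^ k)) ^ (q * M) = 1"
    using \<open>z ^ q = 1\<close> by (metis mult.commute power_mult power_one)
  fix r s I J
  let ?e = "int I * orbit delta (Suc r) s + int J * orbit delta r s"
  have "p powi orbit dyadic_row (r + 12 * 2 ^ k * I) (s + 12 * 2 ^ k * J)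
      = p powi orbit dyadic_row r s"
  proof (cases k)
    case 0
    then show ?thesis using assms by simp
  next
    case (Suc t)
    then show ?thesis
      using assms(1) dyadic_row_periodic[of r t I s J]
      by (intro powi_cong[of _ _ "2 ^ k"]) simp_all
  qed
  moreover have "z powi orbit odd_row (r + 12 * 2 ^ k * I) (s + 12 * 2 ^ k * J)
      = z powi orbit odd_row r s * (z powi int (4 * 2 ^ k)) powi ?e"
    using z0 odd_row_grid[of r "2 ^ k" I s J]
    by (simp add: power_int_add power_int_mult del: orbit.simps power_int_of_nat)
  ultimately show "p powi orbit dyadic_row (r + 12 * 2 ^ k * I) (s + 12 * 2 ^ k * J)
        * z powi orbit odd_row (r + 12 * 2 ^ k * I) (s + 12 * 2 ^ k * J)
      = p powi orbit dyadic_row r s * z powi orbit odd_row r s * (z ^ (4 * 2 ^ k)) powi ?e"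
    by (simp only: power_int_of_nat mult.assoc)
qed simp

text \<open>Fourier inversion: the indicator of \<open>h a = x\<close> is the mean over
  \<open>t < m\<close> of \<open>(w ^ t) powi (h a - x)\<close> for a primitive root of unity
  \<open>w\<close>. After swapping the sums only \<open>t = 0\<close> survives.\<close>

lemma card_fibre_eq:
  fixes h :: "'a \<Rightarrow> int"
  assumes "finite T" "m > 0" "\<And>a. a \<in> T \<Longrightarrow> h a \<in> {0..<int m}"
    and zero: "\<And>w :: complex. w ^ m = 1 \<Longrightarrow> w \<noteq> 1 \<Longrightarrow> (\<Sum>a\<in>T. w powi h a) = 0"
    and x: "x \<in> {0..<int m}"
  shows "m * card {a \<in> T. h a = x} = card T"
proof -
  define w where "w = cis (2 * pi / real m)"
  have w0: "w \<noteq> 0" by (simp add: w_def)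
  have wm: "w ^ m = 1" using \<open>m > 0\<close> by (simp add: w_def DeMoivre)
  have w1: "w ^ t \<noteq> 1" if "0 < t" "t < m" for t
  proof -
    have "inj_on (\<lambda>k. cis (2 * pi * real k / real m)) {..<m}"
      using bij_betw_roots_unity[OF \<open>m > 0\<close>] by (rule bij_betw_imp_inj_on)
    from inj_onD[OF this, of t 0] that show ?thesis
      by (auto simp: w_def DeMoivre mult_ac)
  qed
  have inner: "(\<Sum>t<m. (w ^ t) powi (h a - x)) = (if h a = x then of_nat m else 0)"
    if "a \<in> T" for a
  proof (cases "h a = x")
    case False
    let ?v = "w powi (h a - x)"
    have "?v \<noteq> 1"
    proof (cases "h a > x")
      case True
      then have "?v = w ^ nat (h a - x)" by (simp add: power_int_def)
      then show ?thesis using w1[of "nat (h a - x)"] True assms(3)[OF that] x by auto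
    next
      case False
      then have "?v = inverse (w ^ nat (x - h a))"
        using w0 \<open>h a \<noteq> x\<close> by (auto simp: power_int_def power_inverse)
      then show ?thesis using w1[of "nat (x - h a)"] False \<open>h a \<noteq> x\<close> assms(3)[OF that] x by auto
    qed
    moreover have "?v ^ m = 1"
      using wm by (metis mult.commute power_int_1_left power_int_mult power_int_of_nat)
    moreover have "(w ^ t) powi (h a - x) = ?v ^ t" for t
      by (metis mult.commute power_int_mult power_int_of_nat)
    ultimately show ?thesis using False by (simp add: geometric_sum)
  qed simp
  have "of_nat (m * card {a \<in> T. h a = x}) = (\<Sum>a\<in>T. if h a = x then of_nat m else (0::complex))"
    using \<open>finite T\<close> by (simp add: sum.If_cases Int_def conj_commute)
  also have "\<dots> = (\<Sum>a\<in>T. \<Sum>t<m. (w ^ t) powi (h a - x))"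
    using inner by simp
  also have "\<dots> = (\<Sum>t<m. \<Sum>a\<in>T. (w ^ t) powi (h a - x))"
    by (rule sum.swap)
  also have "\<dots> = (\<Sum>t<m. (\<Sum>a\<in>T. (w ^ t) powi h a) / (w ^ t) powi x)"
    using w0 by (simp add: power_int_diff sum_divide_distrib)
  also have "\<dots> = (\<Sum>t<m. if t = 0 then of_nat (card T) else 0)"
  proof (rule sum.cong)
    fix t assume "t \<in> {..<m}"
    moreover have "(w ^ t) ^ m = 1" using wm by (metis mult.commute power_mult power_one)
    ultimately show "(\<Sum>a\<in>T. (w ^ t) powi h a) / (w ^ t) powi x
        = (if t = 0 then of_nat (card T) else 0)"
      using zero[of "w ^ t"] w1[of t] by auto
  qed simp
  also have "\<dots> = of_nat (card T)" using \<open>m > 0\<close> by simp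
  finally show ?thesis by (simp only: of_nat_eq_iff)
qed

section \<open>Assembling the balanced row\<close>

lemma steinhaus_orbit:
  assumes "i + j < n"
  shows "steinhaus m (map (\<lambda>j. f j mod m) [0..<n]) i j = orbit f i j mod m"
  using assms by (induction i arbitrary: j) (simp_all add: mod_add_eq)

lemma concat_replicate_periodic:
  assumes "\<And>j. g (j + L) = g j"
  shows "concat (replicate lam (map g [0..<L])) = map g [0..<L * lam]"
proof (induction lam)
  case (Suc lam)
  have "map g [0..<L * Suc lam] = map g [0..<L] @ map g [L..<L + L * lam]"
    by (simp add: upt_add_eq_append[of 0 L "L * lam", simplified])
  also have "[L..<L + L * lam] = map (\<lambda>j. j + L) [0..<L * lam]"
    by (simp add: map_add_upt add.commute)
  finally show ?case by (simp add: Suc assms comp_def)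
qed simp

lemma odd_part:
  fixes m :: nat
  assumes "m > 0"
  obtains k q where "m = 2 ^ k * q" "odd q"
  using assms
proof (induction m arbitrary: thesis rule: less_induct)
  case (less m)
  show ?case
  proof (cases "even m")
    case True
    then obtain l where l: "m = 2 * l" by blast
    then obtain k q where "l = 2 ^ k * q" "odd q" using less.IH[of l] less.prems by auto
    then show ?thesis using less.prems(1)[of "Suc k" q] l by simp
  next
    case False
    then show ?thesis using less.prems(1)[of 0 m] by simp
  qed
qed

theorem theorem1:
  fixes m :: nat
  assumes "m > 0"
  shows "\<exists>A :: int list. length A = 12 * m \<and> set A \<subseteq> {0..<int m} \<and>
           (\<forall>lam::nat. balanced (int m) (concat (replicate lam A)))"
proof -
  obtain k q where m: "m = 2 ^ k * q" and q: "odd q" using odd_part[OF assms] .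
  define U where "U = (\<lambda>j. int q * dyadic_row j + 2 ^ k * odd_row j)"
  define A where "A = map (\<lambda>j. U j mod int m) [0..<12 * m]"
  have per: "U (j + 12 * m) mod int m = U j mod int m" for j
  proof -
    \<comment> \<open>For \<open>k = 0\<close> the factor \<open>q\<close> is already
      \<open>m\<close>. Otherwise \<open>12 * m\<close> is a multiple of 24 and the difference
      itself is \<open>m * delta j\<close>.\<close>
    have "int m dvd int q * (dyadic_row (j + 12 * m) - dyadic_row j)"
    proof (cases k)
      case 0
      then show ?thesis by (simp add: m)
    next
      case (Suc t)
      then have "12 * m = 24 * (2 ^ t * q)" by (simp add: m)
      then show ?thesis using dyadic_row_add[of j "2 ^ t * q"] by (simp add: m Suc)
    qed
    moreover have "odd_row (j + 12 * m) - odd_row j = int m * (4 * delta j)"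
      using odd_row_grid[of 0 m 0 j 1] by simp
    then have "int m dvd 2 ^ k * (odd_row (j + 12 * m) - odd_row j)" by simp
    ultimately have "int m dvd int q * (dyadic_row (j + 12 * m) - dyadic_row j)
        + 2 ^ k * (odd_row (j + 12 * m) - odd_row j)"
      by (rule dvd_add)
    then show ?thesis by (simp add: U_def mod_eq_dvd_iff algebra_simps)
  qed
  have sum0: "(\<Sum>(i, j)\<in>tri_idx (12 * m * lam). w powi orbit U i j) = 0"
    if w: "w ^ m = 1" "w \<noteq> 1" for lam and w :: complex
  proof -
    \<comment> \<open>The weights \<open>q\<close> and \<open>2 ^ k\<close> in \<open>U\<close>
      split the character \<open>w\<close> into \<open>p\<close>, whose order is a power of 2, and
      \<open>z\<close>, whose order is odd. Since \<open>2 ^ k\<close> and \<open>q\<close> are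
      coprime, \<open>p\<close> and \<open>z\<close> cannot both be 1.\<close>
    define p z where "p = w ^ q" and "z = w ^ 2 ^ k"
    have p: "p ^ 2 ^ k = 1" and z: "z ^ q = 1"
      using w(1) by (simp_all add: p_def z_def m power_mult[symmetric] mult.commute)
    have w0: "w \<noteq> 0" using w(1) assms by (metis power_0_left zero_neq_one less_numeral_extra(3))
    have U: "w powi orbit U i j = p powi orbit dyadic_row i j * z powi orbit odd_row i j" for i j
    proof -
      have "w powi orbit U i j
          = (w powi int q) powi orbit dyadic_row i j * (w powi int (2 ^ k)) powi orbit odd_row i j"
        unfolding U_def orbit_linear using w0
        by (simp add: power_int_add power_int_mult del: power_int_of_nat)
      then show ?thesis by (simp only: p_def z_def power_int_of_nat)
    qed
    have n: "12 * m * lam = 12 * 2 ^ k * (q * lam)" by (simp add: m)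
    show ?thesis
    proof (cases "z = 1")
      case False
      show ?thesis unfolding U n using p z False q by (rule mixed_char_sum)
    next
      case True
      have "p \<noteq> 1"
        using power_coprime_eq_1[of w "2 ^ k" q] True w(2) q
        by (auto simp: p_def z_def)
      from dyadic_char_sum[OF this p] show ?thesis unfolding U n True by simp
    qed
  qed
  have "balanced (int m) (concat (replicate lam A))" for lam
  proof -
    define n where "n = 12 * m * lam"
    have row: "concat (replicate lam A) = map (\<lambda>j. U j mod int m) [0..<n]"
      unfolding A_def n_def by (rule concat_replicate_periodic) (rule per)
    let ?h = "\<lambda>(i, j). steinhaus (int m) (concat (replicate lam A)) i j"
    have h: "?h a = (case a of (i, j) \<Rightarrow> orbit U i j mod int m)" if "a \<in> tri_idx n" for a
      using that unfolding row by (auto simp: tri_idx_def steinhaus_orbit)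
    have "m * card {a \<in> tri_idx n. ?h a = x} = card (tri_idx n)" if "x \<in> {0..<int m}" for x
    proof (rule card_fibre_eq[OF finite_tri_idx assms _ _ that])
      show "?h a \<in> {0..<int m}" if "a \<in> tri_idx n" for a
        using assms that by (simp add: h split: prod.split)
      show "(\<Sum>a\<in>tri_idx n. w powi ?h a) = 0" if w: "w ^ m = 1" "w \<noteq> 1" for w :: complex
      proof -
        have "(\<Sum>a\<in>tri_idx n. w powi ?h a) = (\<Sum>(i, j)\<in>tri_idx n. w powi orbit U i j)"
        proof (rule sum.cong)
          fix a assume "a \<in> tri_idx n"
          then show "w powi ?h a = (case a of (i, j) \<Rightarrow> w powi orbit U i j)"
            using w(1) assms unfolding h[OF \<open>a \<in> tri_idx n\<close>]
            by (auto intro!: powi_cong simp: cong_def split: prod.split)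
        qed simp
        then show ?thesis using sum0[OF w] by (simp add: n_def)
      qed
    qed
    moreover have "{(i, j) \<in> tri_idx (length (concat (replicate lam A))).
        steinhaus (int m) (concat (replicate lam A)) i j = x} = {a \<in> tri_idx n. ?h a = x}" for x
      unfolding row by auto
    ultimately show ?thesis
      unfolding balanced_def using assms by (metis (no_types, lifting) mult_left_cancel not_gr0)
  qed
  moreover have "length A = 12 * m" "set A \<subseteq> {0..<int m}"
    using assms by (auto simp: A_def)
  ultimately show ?thesis by blast
qed

end
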